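(* Let $p\ge 3$ be an integer. The lobster $L_p$ has a $b$-edge consecutive magic labeling if and only if $b \in \{0,2p+1\}$.
   Context: Graphs are finite and simple, with vertex set $V(G)$ and edge set $E(G)$. An edge-magic total labeling (also called edge-magic labeling or magic valuation) of $G$ is a bijection $\lambda: V(G)\cup E(G)\to\{1,2,\ldots,|V(G)|+|E(G)|\}$ such that $\lambda(x)+\lambda(y)+\lambda(xy)$ is the same constant (the magic constant of $\lambda$) for all edges $xy\in E(G)$. For an integer $b$ with $0\le b\le |V(G)|$, a $b$-edge consecutive magic labeling of $G$ is an edge-magic total labeling $\lambda$ with $\lambda(E(G))=\{b+1,b+2,\ldots,b+|E(G)|\}$. For a positive integer $p$, $L_p$ is the tree obtained from the star with $p$ leaves by attaching one new leaf to each leaf of the star; that is, $L_p$ has vertices $x,y_1,\ldots,y_p,x_1,\ldots,x_p$ and edges $xy_i$ and $y_ix_i$ for $i=1,\ldots,p$. *)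

theory Defs
  imports Main
begin

definition simple_graph :: "'a set \<Rightarrow> 'a set set \<Rightarrow> bool" where
  "simple_graph V E \<longleftrightarrow> finite V \<and> (\<forall>e\<in>E. e \<subseteq> V \<and> card e = 2)"

text \<open>A total labeling is a function on the disjoint sum of vertices and edges:
  \<open>Inl v\<close> is the vertex \<open>v\<close> and \<open>Inr e\<close> is the edge \<open>e\<close>.\<close>

definition edge_magic_total_labeling ::
    "'a set \<Rightarrow> 'a set set \<Rightarrow> ('a + 'a set \<Rightarrow> nat) \<Rightarrow> bool" where
  "edge_magic_total_labeling V E lam \<longleftrightarrow>
     simple_graph V E \<and>
     bij_betw lam (V <+> E) {1..card V + card E} \<and>
     (\<exists>k. \<forall>x y. {x, y} \<in> E \<longrightarrow> lam (Inl x) + lam (Inl y) + lam (Inr {x, y}) = k)"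

definition edge_consecutive_magic_labeling ::
    "nat \<Rightarrow> 'a set \<Rightarrow> 'a set set \<Rightarrow> ('a + 'a set \<Rightarrow> nat) \<Rightarrow> bool" where
  "edge_consecutive_magic_labeling b V E lam \<longleftrightarrow>
     b \<le> card V \<and>
     edge_magic_total_labeling V E lam \<and>
     lam ` (Inr ` E) = {b + 1..b + card E}"

text \<open>The vertices \<open>x\<close>, \<open>y\<^sub>i\<close> and \<open>x\<^sub>i\<close> of the lobster are
  \<open>Center\<close>, \<open>Mid i\<close> and \<open>Leaf i\<close>.\<close>

datatype lobster_vertex = Center | Mid nat | Leaf nat

definition lobster_verts :: "nat \<Rightarrow> lobster_vertex set" where
  "lobster_verts p = {Center} \<union> Mid ` {1..p} \<union> Leaf ` {1..p}"

definition lobster_edges :: "nat \<Rightarrow> lobster_vertex set set" where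
  "lobster_edges p = (\<lambda>i. {Center, Mid i}) ` {1..p} \<union> (\<lambda>i. {Mid i, Leaf i}) ` {1..p}"

lemma simple_graph_lobster: "simple_graph (lobster_verts p) (lobster_edges p)"
  by (auto simp: simple_graph_def lobster_verts_def lobster_edges_def)

lemma card_lobster_verts: "card (lobster_verts p) = 2 * p + 1"
proof -
  have "card (Mid ` {1..p} \<union> Leaf ` {1..p}) = p + p"
    by (subst card_Un_disjoint) (auto simp: card_image inj_on_def)
  moreover have "Center \<notin> Mid ` {1..p} \<union> Leaf ` {1..p}" by auto
  ultimately show ?thesis
    by (simp add: lobster_verts_def)
qed

lemma card_lobster_edges: "card (lobster_edges p) = 2 * p"
proof -
  have "inj_on (\<lambda>i. {Center, Mid i}) {1..p}" "inj_on (\<lambda>i. {Mid i, Leaf i}) {1..p}"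
    by (auto simp: inj_on_def doubleton_eq_iff)
  then show ?thesis
    unfolding lobster_edges_def
    by (subst card_Un_disjoint) (auto simp: card_image doubleton_eq_iff)
qed

end

theory Submission
  imports Defs
begin

text \<open>
  Write \<open>n = 2 * p + 1\<close> for the number of vertices and \<open>m = 2 * p\<close> for the number of edges.
  The edges carry \<open>m\<close> consecutive labels and the sum of vertex labels at an edge is the magic
  constant minus the edge label, so these sums are \<open>m\<close> consecutive integers as well. Everything
  is about vertex labelings with this property.

  For \<open>b = 0\<close> and \<open>b = n\<close> the vertices carry consecutive labels too, and it suffices to label
  them bijectively by \<open>0, ..., n - 1\<close> so that the sums at the edges are consecutive
  (\<open>consecutive_sums_imp_labeling\<close>). Explicit labelings depend on the parity of \<open>p\<close>
  (\<open>odd_lobster_labeling\<close>, \<open>even_lobster_labeling\<close>).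

  Now let \<open>0 < b < n\<close>. The labels of vertices split into low ones, at most \<open>b\<close>, and high ones,
  at least \<open>b + m + 1\<close>. This gap is so wide that the sums at edges of type low-low, low-high and
  high-high are separated by missing values; as the sums are consecutive and a connected graph has
  some low-high edge, all edges are of that type (\<open>all_crossing\<close>). The sums then lie between
  \<open>1 + (b + m + 1)\<close> and \<open>b + (n + m)\<close>. This interval has only \<open>m\<close> elements, so each one is
  attained (\<open>crossing_sums\<close>). The smallest sum comes from the smallest low and the smallest high
  label, and the next sum changes only one of them: the two edges share a vertex. The same holds
  at the top.
  In a lobster two edges with a common vertex involve the center, so the label of the center is at
  the same time within one of the minimum and within one of the maximum of its class, low or high
  (\<open>smallest_sums\<close>, \<open>largest_sums\<close>). But every edge at the center is of type low-high, as are the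
  edges at the leaves, so the class of the center consists of the center and the \<open>p\<close> leaves.
  It has \<open>p + 1 \<ge> 4\<close> consecutive labels, a contradiction.
\<close>

section \<open>Labelings with all edge labels below or above the vertex labels\<close>

text \<open>An edge receives the difference between a constant and its sum, so consecutive sums turn into
  consecutive edge labels. For \<open>b = 0\<close> the vertex labels are shifted past the edge labels.\<close>

lemma consecutive_sums_imp_labeling:
  assumes G: "simple_graph V E" and f: "bij_betw f V {..<card V}"
    and sums: "bij_betw (sum f) E {S..<S + card E}"
    and b: "b \<in> {0, card V}"
  shows "\<exists>lam. edge_consecutive_magic_labeling b V E lam"
proof -
  define d where "d = (if b = 0 then card E else 0)"
  define g where "g = (\<lambda>v. f v + d + 1)"
  define h where "h = (\<lambda>e. b + S + card E - sum f e)"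
  define lam where "lam = case_sum g h"
  have "bij_betw (\<lambda>k. k + d + 1) {..<card V} {d + 1..d + card V}"
    by (rule bij_betw_byWitness[where f' = "\<lambda>k. k - d - 1"]) auto
  from bij_betw_trans[OF f this] have "bij_betw g V {d + 1..d + card V}"
    by (simp add: g_def o_def)
  then have g: "bij_betw lam (Inl ` V) {d + 1..d + card V}"
    by (auto simp: bij_betw_def lam_def inj_on_def image_image)
  have "bij_betw (\<lambda>s. b + S + card E - s) {S..<S + card E} {b + 1..b + card E}"
    by (rule bij_betw_byWitness[where f' = "\<lambda>k. b + S + card E - k"]) auto
  from bij_betw_trans[OF sums this] have "bij_betw h E {b + 1..b + card E}"
    by (simp add: h_def o_def)
  then have h: "bij_betw lam (Inr ` E) {b + 1..b + card E}"
    by (auto simp: bij_betw_def lam_def inj_on_def image_image)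
  have "{d + 1..d + card V} \<inter> {b + 1..b + card E} = {}"
    "{d + 1..d + card V} \<union> {b + 1..b + card E} = {1..card V + card E}"
    using b by (auto simp: d_def)
  with bij_betw_combine[OF g h] have lam: "bij_betw lam (V <+> E) {1..card V + card E}"
    by (simp add: Plus_def)
  have magic: "lam (Inl x) + lam (Inl y) + lam (Inr {x, y}) = 2 * d + 2 + b + S + card E"
    if e: "{x, y} \<in> E" for x y
  proof -
    have "x \<noteq> y"
      using G e by (auto simp: simple_graph_def)
    then have s: "sum f {x, y} = f x + f y" by simp
    have "sum f {x, y} < S + card E"
      using bij_betw_apply[OF sums e] by simp
    then show ?thesis
      by (simp add: lam_def g_def h_def s)
  qed
  show ?thesis
    unfolding edge_consecutive_magic_labeling_def edge_magic_total_labeling_def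
    using b G lam magic bij_betw_imp_surj_on[OF h] by blast
qed

section \<open>Labelings of the lobster\<close>

definition lobster_map :: "nat \<Rightarrow> (nat \<Rightarrow> nat) \<Rightarrow> (nat \<Rightarrow> nat) \<Rightarrow> lobster_vertex \<Rightarrow> nat" where
  "lobster_map c y x v = (case v of Center \<Rightarrow> c | Mid i \<Rightarrow> y i | Leaf i \<Rightarrow> x i)"

text \<open>For the arithmetic, the labels of a leg are best given by a relation: \<open>leg i u v\<close> is to
  mean that \<open>Mid i\<close> has label \<open>u\<close> and \<open>Leaf i\<close> has label \<open>v\<close>. Every hypothesis
  then is a quantified statement about linear expressions, free of the labeling functions.\<close>

lemma lobster_legs_imp_labeling:
  fixes leg :: "nat \<Rightarrow> nat \<Rightarrow> nat \<Rightarrow> bool"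
  assumes total: "\<And>i. i \<in> {1..p} \<Longrightarrow> \<exists>u v. leg i u v"
    and c_range: "c \<le> 2 * p"
    and range: "\<And>i u v. leg i u v \<Longrightarrow> u \<le> 2 * p \<and> v \<le> 2 * p"
    and inj_mid: "\<And>i j u v u' v'. leg i u v \<Longrightarrow> leg j u' v' \<Longrightarrow> u = u' \<Longrightarrow> i = j"
    and inj_leaf: "\<And>i j u v u' v'. leg i u v \<Longrightarrow> leg j u' v' \<Longrightarrow> v = v' \<Longrightarrow> i = j"
    and c_fresh: "\<And>i u v. leg i u v \<Longrightarrow> c \<noteq> u \<and> c \<noteq> v"
    and disj: "\<And>i j u v u' v'. leg i u v \<Longrightarrow> leg j u' v' \<Longrightarrow> u \<noteq> v'"
    and sum_range: "\<And>i u v. leg i u v \<Longrightarrow> c + u \<in> {S..<S + 2 * p} \<and> u + v \<in> {S..<S + 2 * p}"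
    and sum_inj: "\<And>i j u v u' v'. leg i u v \<Longrightarrow> leg j u' v' \<Longrightarrow> u + v = u' + v' \<Longrightarrow> i = j"
    and sum_disj: "\<And>i j u v u' v'. leg i u v \<Longrightarrow> leg j u' v' \<Longrightarrow> c + u \<noteq> u' + v'"
    and b: "b \<in> {0, 2 * p + 1}"
  shows "\<exists>lam. edge_consecutive_magic_labeling b (lobster_verts p) (lobster_edges p) lam"
proof -
  obtain y x where leg: "leg i (y i) (x i)" if "i \<in> {1..p}" for i
    using total by metis
  let ?f = "lobster_map c y x"
  have "inj_on ?f (lobster_verts p)"
  proof (rule inj_onI)
    fix u v assume "u \<in> lobster_verts p" "v \<in> lobster_verts p" "?f u = ?f v"
    then show "u = v"
      unfolding lobster_verts_def
      by (elim UnE imageE singletonE; simp only: lobster_map_def lobster_vertex.case)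
        (metis inj_mid[OF leg leg] inj_leaf[OF leg leg] c_fresh[OF leg] disj[OF leg leg])+
  qed
  moreover have "?f ` lobster_verts p \<subseteq> {..<card (lobster_verts p)}"
    using c_range range[OF leg] unfolding card_lobster_verts unfolding lobster_verts_def
    by (auto simp: lobster_map_def less_Suc_eq_le)
  ultimately have f: "bij_betw ?f (lobster_verts p) {..<card (lobster_verts p)}"
    by (simp add: bij_betw_def card_image card_subset_eq)
  have sums: "sum ?f {Center, Mid i} = c + y i" "sum ?f {Mid i, Leaf i} = y i + x i" for i
    by (simp_all add: lobster_map_def)
  have "inj_on (sum ?f) (lobster_edges p)"
  proof (rule inj_onI)
    fix d e assume "d \<in> lobster_edges p" "e \<in> lobster_edges p" "sum ?f d = sum ?f e"
    then show "d = e"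
      unfolding lobster_edges_def
    proof (elim UnE imageE; simp only: sums)
      show "{Center, Mid i} = {Center, Mid j}"
        if "c + y i = c + y j" "i \<in> {1..p}" "j \<in> {1..p}" for i j
        using inj_mid[OF leg leg, of i j] that by simp
      show "{Mid i, Leaf i} = {Mid j, Leaf j}"
        if "y i + x i = y j + x j" "i \<in> {1..p}" "j \<in> {1..p}" for i j
        using sum_inj[OF leg leg, of i j] that by simp
    qed (use leg sum_disj in metis)+
  qed
  moreover have "sum ?f ` lobster_edges p \<subseteq> {S..<S + card (lobster_edges p)}"
    using sum_range[OF leg] unfolding card_lobster_edges unfolding lobster_edges_def
    by (auto simp: sums)
  ultimately have "bij_betw (sum ?f) (lobster_edges p) {S..<S + card (lobster_edges p)}"
    by (simp add: bij_betw_def card_image card_subset_eq)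
  moreover have "b \<in> {0, card (lobster_verts p)}"
    using b by (simp add: card_lobster_verts)
  ultimately show ?thesis
    by (rule consecutive_sums_imp_labeling[OF simple_graph_lobster f])
qed

text \<open>For odd \<open>p\<close> the center gets the middle label \<open>p\<close>, each middle vertex an odd label
  \<open>u \<noteq> p\<close>, and the leaf behind it the even label \<open>u + p\<close> or \<open>u - p\<close>, whichever is in
  range. The label pair \<open>(0, 2 * p)\<close> is left for the leg that would have used \<open>u = p\<close>.
  Then the sums at the center are \<open>p\<close> and the even numbers between \<open>p\<close> and \<open>3 * p\<close>
  except \<open>2 * p\<close>; the sums at the leaves are \<open>2 * p\<close> and the numbers \<open>2 * u + p\<close>
  and \<open>2 * u - p\<close>, which are the odd numbers strictly between \<open>p\<close> and \<open>3 * p\<close>.\<close>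

lemma odd_lobster_labeling:
  assumes "odd p" and b: "b \<in> {0, 2 * p + 1}"
  shows "\<exists>lam. edge_consecutive_magic_labeling b (lobster_verts p) (lobster_edges p) lam"
proof -
  from \<open>odd p\<close> obtain m where p: "p = 2 * m + 1" by (rule oddE)
  define leg where "leg i u v \<longleftrightarrow>
      (\<exists>a<m. i = a + 1 \<and> u = 2 * a + 1 \<and> v = 2 * a + 2 * m + 2)
    \<or> i = m + 1 \<and> u = 0 \<and> v = 4 * m + 2
    \<or> (\<exists>a<m. i = m + 2 + a \<and> u = 2 * m + 2 * a + 3 \<and> v = 2 * a + 2)" for i u v :: nat
  have total: "\<exists>u v. leg i u v" if i: "i \<in> {1..p}" for i
  proof -
    consider "i \<le> m" | "i = m + 1" | "m + 2 \<le> i" by linarith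
    then show ?thesis
    proof cases
      case 1
      with i have "i = (i - 1) + 1" "i - 1 < m" by auto
      then show ?thesis unfolding leg_def by blast
    next
      case 3
      with i p have "i = m + 2 + (i - m - 2)" "i - m - 2 < m" by auto
      then show ?thesis unfolding leg_def by blast
    qed (auto simp: leg_def)
  qed
  show ?thesis
  proof (rule lobster_legs_imp_labeling[where leg = leg and c = "p" and S = "p", OF total])
    \<comment> \<open>Each pair of cases leaves a linear equation, which fails by size or modulo 2 or 4.\<close>
    show "\<And>i j u v u' v'. leg i u v \<Longrightarrow> leg j u' v' \<Longrightarrow> u \<noteq> v'"
      "\<And>i j u v u' v'. leg i u v \<Longrightarrow> leg j u' v' \<Longrightarrow> p + u \<noteq> u' + v'"
      "\<And>i j u v u' v'. leg i u v \<Longrightarrow> leg j u' v' \<Longrightarrow> u = u' \<Longrightarrow> i = j"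
      "\<And>i j u v u' v'. leg i u v \<Longrightarrow> leg j u' v' \<Longrightarrow> v = v' \<Longrightarrow> i = j"
      "\<And>i j u v u' v'. leg i u v \<Longrightarrow> leg j u' v' \<Longrightarrow> u + v = u' + v' \<Longrightarrow> i = j"
      unfolding leg_def p by (elim disjE exE conjE; clarsimp; presburger?)+
    show "\<And>i u v. leg i u v \<Longrightarrow> u \<le> 2 * p \<and> v \<le> 2 * p"
      "\<And>i u v. leg i u v \<Longrightarrow> p \<noteq> u \<and> p \<noteq> v"
      "\<And>i u v. leg i u v \<Longrightarrow> p + u \<in> {p..<p + 2 * p} \<and> u + v \<in> {p..<p + 2 * p}"
      unfolding leg_def p by (elim disjE exE conjE; clarsimp; presburger?)+
  qed (use b in simp_all)
qed

text \<open>For even \<open>p\<close> the same idea works with center \<open>p - 1\<close> and shift \<open>p - 1\<close>, but four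
  legs have to be adjusted at the boundary: they carry the pairs \<open>(2, p + 1)\<close>,
  \<open>(2 * p - 2, 0)\<close>, \<open>(2 * p, p)\<close> and \<open>(2 * p - 1, 1)\<close>. The sums fill the interval from
  \<open>p + 1\<close> to \<open>3 * p\<close>. The bound \<open>p \<ge> 4\<close> gives these four legs different indices.\<close>

lemma even_lobster_labeling:
  assumes "even p" and "p \<ge> 4" and b: "b \<in> {0, 2 * p + 1}"
  shows "\<exists>lam. edge_consecutive_magic_labeling b (lobster_verts p) (lobster_edges p) lam"
proof -
  from \<open>even p\<close> obtain m where "p = 2 * m" by (rule evenE)
  with \<open>p \<ge> 4\<close> have "p = 2 * (m - 2) + 4" by simp
  then obtain n where p: "p = 2 * n + 4" ..
  define leg where "leg i u v \<longleftrightarrow>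
      i = 1 \<and> u = 2 \<and> v = 2 * n + 5
    \<or> (\<exists>a<n. i = a + 2 \<and> u = 2 * a + 3 \<and> v = 2 * a + 2 * n + 6)
    \<or> i = n + 2 \<and> u = 4 * n + 6 \<and> v = 0
    \<or> i = n + 3 \<and> u = 4 * n + 8 \<and> v = 2 * n + 4
    \<or> (\<exists>a<n. i = n + 4 + a \<and> u = 2 * n + 2 * a + 7 \<and> v = 2 * a + 4)
    \<or> i = 2 * n + 4 \<and> u = 4 * n + 7 \<and> v = 1" for i u v :: nat
  have total: "\<exists>u v. leg i u v" if i: "i \<in> {1..p}" for i
  proof -
    consider "i = 1" | "2 \<le> i" "i < n + 2" | "i = n + 2" | "i = n + 3"
      | "n + 4 \<le> i" "i < 2 * n + 4" | "i = 2 * n + 4"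
      using i unfolding p atLeastAtMost_iff by linarith
    then show ?thesis
    proof cases
      case 2
      then have "i = (i - 2) + 2" "i - 2 < n" by auto
      then show ?thesis unfolding leg_def by blast
    next
      case 5
      then have "i = n + 4 + (i - n - 4)" "i - n - 4 < n" by auto
      then show ?thesis unfolding leg_def by blast
    qed (auto simp: leg_def)
  qed
  show ?thesis
  proof (rule lobster_legs_imp_labeling[where leg = leg and c = "p - 1" and S = "p + 1", OF total])
    \<comment> \<open>Each pair of cases leaves a linear equation, which fails by size or modulo 2 or 4.\<close>
    show "\<And>i j u v u' v'. leg i u v \<Longrightarrow> leg j u' v' \<Longrightarrow> u \<noteq> v'"
      "\<And>i j u v u' v'. leg i u v \<Longrightarrow> leg j u' v' \<Longrightarrow> p - 1 + u \<noteq> u' + v'"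
      "\<And>i j u v u' v'. leg i u v \<Longrightarrow> leg j u' v' \<Longrightarrow> u = u' \<Longrightarrow> i = j"
      "\<And>i j u v u' v'. leg i u v \<Longrightarrow> leg j u' v' \<Longrightarrow> v = v' \<Longrightarrow> i = j"
      "\<And>i j u v u' v'. leg i u v \<Longrightarrow> leg j u' v' \<Longrightarrow> u + v = u' + v' \<Longrightarrow> i = j"
      unfolding leg_def p by (elim disjE exE conjE; clarsimp; presburger?)+
    show "\<And>i u v. leg i u v \<Longrightarrow> u \<le> 2 * p \<and> v \<le> 2 * p"
      "\<And>i u v. leg i u v \<Longrightarrow> p - 1 \<noteq> u \<and> p - 1 \<noteq> v"
      "\<And>i u v. leg i u v \<Longrightarrow> p - 1 + u \<in> {p + 1..<p + 1 + 2 * p} \<and> u + v \<in> {p + 1..<p + 1 + 2 * p}"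
      unfolding leg_def p by (elim disjE exE conjE; clarsimp; presburger?)+
  qed (use b in simp_all)
qed

section \<open>Edge sums in a labeling with consecutive edge labels\<close>

locale edge_consecutive_labeling =
  fixes b :: nat and V :: "'a set" and E :: "'a set set" and lam :: "'a + 'a set \<Rightarrow> nat"
  assumes labeling: "edge_consecutive_magic_labeling b V E lam"
begin

abbreviation label :: "'a \<Rightarrow> nat" where "label v \<equiv> lam (Inl v)"

lemma graph: "simple_graph V E"
  using labeling by (simp add: edge_consecutive_magic_labeling_def edge_magic_total_labeling_def)

lemma finite_V: "finite V"
  using graph by (simp add: simple_graph_def)

lemma edgeE:
  assumes "e \<in> E"
  obtains x y where "e = {x, y}" "x \<in> V" "y \<in> V" "x \<noteq> y"
  using assms graph by (force simp: simple_graph_def card_2_iff)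

lemma finite_E: "finite E"
proof (rule finite_subset)
  show "E \<subseteq> Pow V"
    using graph by (auto simp: simple_graph_def)
qed (simp add: finite_V)

lemma lam_bij: "bij_betw lam (V <+> E) {1..card V + card E}"
  using labeling by (simp add: edge_consecutive_magic_labeling_def edge_magic_total_labeling_def)

lemma inj_on_label: "inj_on label V"
  using bij_betw_imp_inj_on[OF lam_bij] by (auto simp: inj_on_def)

lemma edge_labels: "(\<lambda>e. lam (Inr e)) ` E = {b + 1..b + card E}"
  using labeling by (simp add: edge_consecutive_magic_labeling_def image_image)

lemma labels: "label ` V = {1..b} \<union> {b + card E + 1..card V + card E}"
proof -
  have b: "b \<le> card V"
    using labeling by (simp add: edge_consecutive_magic_labeling_def)
  have "(V <+> E) - Inr ` E = Inl ` V"
    by auto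
  then have "lam ` Inl ` V = lam ` (V <+> E) - lam ` Inr ` E"
    using bij_betw_imp_inj_on[OF lam_bij] by (metis Plus_def Un_upper2 inj_on_image_set_diff Diff_subset)
  also have "\<dots> = {1..card V + card E} - {b + 1..b + card E}"
    using bij_betw_imp_surj_on[OF lam_bij] edge_labels by (simp add: image_image)
  also have "\<dots> = {1..b} \<union> {b + card E + 1..card V + card E}"
    using b by auto
  finally show ?thesis
    by (simp add: image_image)
qed

lemma low_or_high:
  assumes "v \<in> V"
  shows "label v \<in> {1..b} \<or> label v \<in> {b + card E + 1..card V + card E}"
  using labels assms by blast

lemma card_low: "card {v \<in> V. label v \<le> b} = b"
proof -
  have "label ` {v \<in> V. label v \<le> b} = label ` V \<inter> {..b}"
    by auto
  also have "\<dots> = {1..b}"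
    unfolding labels by auto
  finally have "card (label ` {v \<in> V. label v \<le> b}) = b"
    by simp
  moreover have "inj_on label {v \<in> V. label v \<le> b}"
    using inj_on_label by (rule inj_on_subset) auto
  ultimately show ?thesis
    by (simp add: card_image)
qed

text \<open>The sum at an edge is the magic constant minus the edge label, and the edge labels are
  consecutive.\<close>

lemma sums_consecutive: "\<exists>S. bij_betw (sum label) E {S..<S + card E}"
proof (cases "E = {}")
  case False
  obtain k where k: "\<And>x y. {x, y} \<in> E \<Longrightarrow> label x + label y + lam (Inr {x, y}) = k"
    using labeling by (auto simp: edge_consecutive_magic_labeling_def edge_magic_total_labeling_def)
  have sum: "sum label e + lam (Inr e) = k" if e: "e \<in> E" for e
  proof -
    obtain x y where "e = {x, y}" "x \<noteq> y"
      using e by (rule edgeE)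
    with e k[of x y] show ?thesis
      by simp
  qed
  have "card E > 0"
    using False finite_E by (simp add: card_gt_0_iff)
  then have "b + card E \<in> (\<lambda>e. lam (Inr e)) ` E"
    unfolding edge_labels by auto
  then obtain e where "e \<in> E" "lam (Inr e) = b + card E"
    by auto
  with sum[of e] have "k \<ge> b + card E"
    by linarith
  moreover have "lam (Inr e) \<in> {b + 1..b + card E}" if "e \<in> E" for e
    using that edge_labels by blast
  ultimately have "sum label ` E \<subseteq> {k - b - card E..<k - b - card E + card E}"
    using sum by fastforce
  moreover have inj: "inj_on (sum label) E"
  proof (rule inj_onI)
    fix d e assume "d \<in> E" "e \<in> E" "sum label d = sum label e"
    then have "lam (Inr d) = lam (Inr e)"
      using sum[of d] sum[of e] by simp
    with \<open>d \<in> E\<close> \<open>e \<in> E\<close> show "d = e"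
      using bij_betw_imp_inj_on[OF lam_bij] by (auto simp: inj_on_def)
  qed
  ultimately have "bij_betw (sum label) E {k - b - card E..<k - b - card E + card E}"
    by (simp add: bij_betw_def card_image card_subset_eq)
  then show ?thesis
    by blast
qed (simp add: bij_betw_def)

lemma sum_between:
  assumes "d \<in> E" "e \<in> E" "sum label d \<le> t" "t \<le> sum label e"
  obtains e' where "e' \<in> E" "sum label e' = t"
proof -
  obtain S where S: "sum label ` E = {S..<S + card E}"
    using sums_consecutive by (auto simp: bij_betw_def)
  then have "t \<in> sum label ` E"
    using assms by (smt (verit) atLeastLessThan_iff image_eqI le_trans order_le_less_trans)
  then show thesis
    using that by blast
qed

text \<open>An edge is crossing if it joins a low vertex, labeled at most \<open>b\<close>, to a high one, labeled
  above all edges.\<close>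

definition crossing :: "'a set \<Rightarrow> bool" where
  "crossing e \<longleftrightarrow> (\<exists>x y. e = {x, y} \<and> x \<in> V \<and> y \<in> V \<and> label x \<le> b \<and> b < label y)"

text \<open>The extreme values are the minimum of the low labels plus that of the high labels, and the
  same with maxima.\<close>

lemma crossing_sum:
  assumes "crossing e"
  shows "sum label e \<in> {b + card E + 2..b + card V + card E}"
proof -
  obtain x y where e: "e = {x, y}" "x \<in> V" "y \<in> V" "label x \<le> b" "b < label y"
    using assms by (auto simp: crossing_def)
  then have "x \<noteq> y" by auto
  then show ?thesis
    using e low_or_high[of x] low_or_high[of y] by auto
qed

text \<open>Two distinct low labels add up to at most \<open>2 * b - 1\<close>, and two distinct high labels to at
  least \<open>2 * (b + card E + 1) + 1\<close>.\<close>

lemma not_crossing_sum: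
  assumes "e \<in> E" "\<not> crossing e"
  shows "sum label e < 2 * b \<or> 2 * b + 2 * card E + 2 < sum label e"
proof -
  obtain x y where e: "e = {x, y}" "x \<in> V" "y \<in> V" "x \<noteq> y"
    using assms(1) by (rule edgeE)
  have "label x \<noteq> label y"
    using e inj_on_label by (auto simp: inj_on_def)
  moreover have "label x \<le> b \<longleftrightarrow> label y \<le> b"
    using assms(2) e by (force simp: crossing_def insert_commute not_le)
  ultimately show ?thesis
    using e low_or_high[of x] low_or_high[of y] by auto
qed

text \<open>By the two previous lemmas neither \<open>2 * b\<close> nor \<open>2 * b + 2 * card E + 2\<close> is the sum at an
  edge. The first lies between the low-low sums and the crossing ones, the second between the
  crossing sums and the high-high ones, so consecutive sums cannot be of two types. The bound on
  \<open>card V\<close> holds in every connected graph.\<close>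

lemma all_crossing:
  assumes "card V \<le> card E + 1" and d: "d \<in> E" "crossing d" and e: "e \<in> E"
  shows "crossing e"
proof (rule ccontr)
  have b: "b \<le> card V"
    using labeling by (simp add: edge_consecutive_magic_labeling_def)
  assume "\<not> crossing e"
  from not_crossing_sum[OF e this] show False
  proof
    assume "sum label e < 2 * b"
    moreover have "2 * b < sum label d"
      using crossing_sum[OF d(2)] b assms(1) by auto
    ultimately obtain e' where "e' \<in> E" "sum label e' = 2 * b"
      using sum_between[OF e d(1), of "2 * b"] by auto
    then show False
      using crossing_sum[of e'] not_crossing_sum[of e'] b assms(1) by fastforce
  next
    assume "2 * b + 2 * card E + 2 < sum label e"
    moreover have "sum label d < 2 * b + 2 * card E + 2"
      using crossing_sum[OF d(2)] b assms(1) by auto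
    ultimately obtain e' where "e' \<in> E" "sum label e' = 2 * b + 2 * card E + 2"
      using sum_between[OF d(1) e, of "2 * b + 2 * card E + 2"] by auto
    then show False
      using crossing_sum[of e'] not_crossing_sum[of e'] b assms(1) by fastforce
  qed
qed

text \<open>In a tree with only crossing edges there are exactly as many edges as possible sums.\<close>

lemma crossing_sums:
  assumes "card V = card E + 1" and "\<forall>e\<in>E. crossing e"
  shows "sum label ` E = {b + card E + 2..b + card V + card E}"
proof (rule card_subset_eq)
  show "sum label ` E \<subseteq> {b + card E + 2..b + card V + card E}"
    using assms(2) crossing_sum by blast
  obtain S where "bij_betw (sum label) E {S..<S + card E}"
    using sums_consecutive by blast
  then have "card (sum label ` E) = card E"
    by (metis bij_betw_imp_inj_on card_image)
  then show "card (sum label ` E) = card {b + card E + 2..b + card V + card E}"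
    using assms(1) by simp
qed simp

text \<open>The smallest sum arises only from the labels \<open>1\<close> and \<open>b + card E + 1\<close>. The second smallest
  arises by raising one of these two by one, so it belongs to an edge that keeps the other
  endpoint.\<close>

lemma smallest_sums:
  assumes tree: "card V = card E + 1" and cross: "\<forall>e\<in>E. crossing e" and "card E \<ge> 2"
  shows "\<exists>d\<in>E. \<exists>e\<in>E. d \<noteq> e \<and> d \<inter> e \<noteq> {} \<and>
    (\<forall>v\<in>d \<union> e. label v \<le> 2 \<or> b < label v \<and> label v \<le> b + card E + 2)"
proof -
  have "b + card E + 2 \<in> sum label ` E" "b + card E + 3 \<in> sum label ` E"
    unfolding crossing_sums[OF tree cross] using assms by auto
  then obtain d e where d: "d \<in> E" "sum label d = b + card E + 2"
    and e: "e \<in> E" "sum label e = b + card E + 3"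
    by force
  obtain x y where xy: "d = {x, y}" "x \<in> V" "y \<in> V" "label x \<le> b" "b < label y"
    using cross d(1) by (auto simp: crossing_def)
  obtain z w where zw: "e = {z, w}" "z \<in> V" "w \<in> V" "label z \<le> b" "b < label w"
    using cross e(1) by (auto simp: crossing_def)
  have neq: "x \<noteq> y" "z \<noteq> w" using xy zw by auto
  have x: "label x = 1 \<and> label y = b + card E + 1"
    using d xy neq low_or_high[of x] low_or_high[of y] by auto
  have z: "label z = 1 \<and> label w = b + card E + 2 \<or> label z = 2 \<and> label w = b + card E + 1"
    using e zw neq low_or_high[of z] low_or_high[of w] by auto
  have "x = z \<or> y = w"
    using x z inj_onD[OF inj_on_label] xy(2,3) zw(2,3) by metis
  moreover have "\<forall>v\<in>d \<union> e. label v \<le> 2 \<or> b < label v \<and> label v \<le> b + card E + 2"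
    using x z xy(1,5) zw(1,4,5) by auto
  ultimately have "d \<inter> e \<noteq> {} \<and> (\<forall>v\<in>d \<union> e. label v \<le> 2 \<or> b < label v \<and> label v \<le> b + card E + 2)"
    using xy(1) zw(1) by auto
  moreover have "d \<noteq> e"
    using d e by auto
  ultimately show ?thesis
    using d(1) e(1) by blast
qed

text \<open>The mirror image at the top: the largest sum takes both largest labels, \<open>b\<close> and
  \<open>card V + card E\<close>, and the next one lowers only one of them.\<close>

lemma largest_sums:
  assumes tree: "card V = card E + 1" and cross: "\<forall>e\<in>E. crossing e" and "card E \<ge> 2"
  shows "\<exists>d\<in>E. \<exists>e\<in>E. d \<noteq> e \<and> d \<inter> e \<noteq> {} \<and>
    (\<forall>v\<in>d \<union> e. label v \<le> b \<and> b \<le> label v + 1 \<or> card V + card E \<le> label v + 1)"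
proof -
  have sums: "b + card V + card E \<in> sum label ` E" "b + card V + card E - 1 \<in> sum label ` E"
    unfolding crossing_sums[OF tree cross] using assms by auto
  from sums(1) obtain d where d: "b + card V + card E = sum label d" "d \<in> E"
    by (rule imageE)
  from sums(2) obtain e where e: "b + card V + card E - 1 = sum label e" "e \<in> E"
    by (rule imageE)
  obtain x y where xy: "d = {x, y}" "x \<in> V" "y \<in> V" "label x \<le> b" "b < label y"
    using cross d(2) by (auto simp: crossing_def)
  obtain z w where zw: "e = {z, w}" "z \<in> V" "w \<in> V" "label z \<le> b" "b < label w"
    using cross e(2) by (auto simp: crossing_def)
  have neq: "x \<noteq> y" "z \<noteq> w" using xy zw by auto
  have x: "label x = b \<and> label y = card V + card E"
    using d xy neq low_or_high[of x] low_or_high[of y] by auto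
  have z: "label z = b \<and> label w + 1 = card V + card E \<or> label z + 1 = b \<and> label w = card V + card E"
    using e zw neq low_or_high[of z] low_or_high[of w] by auto
  have "x = z \<or> y = w"
    using x z inj_onD[OF inj_on_label] xy(2,3) zw(2,3) by metis
  moreover have "\<forall>v\<in>d \<union> e. label v \<le> b \<and> b \<le> label v + 1 \<or> card V + card E \<le> label v + 1"
    using x z xy(1,5) zw(1,4,5) by auto
  ultimately have "d \<inter> e \<noteq> {} \<and> (\<forall>v\<in>d \<union> e. label v \<le> b \<and> b \<le> label v + 1 \<or> card V + card E \<le> label v + 1)"
    using xy(1) zw(1) by auto
  moreover have "d \<noteq> e"
    using d e tree by auto
  ultimately show ?thesis
    using d(2) e(2) by blast
qed

end

section \<open>The characterization for the lobster\<close>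

text \<open>The edges that avoid the center form a matching.\<close>

lemma center_in_adjacent_edges:
  assumes "d \<in> lobster_edges p" "e \<in> lobster_edges p" "d \<noteq> e" "d \<inter> e \<noteq> {}"
  shows "Center \<in> d \<union> e"
  using assms by (auto simp: lobster_edges_def)

text \<open>If \<open>b\<close> is neither \<open>0\<close> nor the number of vertices, then the \<open>p + 1\<close> vertices on the side
  of the center have consecutive labels. The label of the center is both one of the two smallest
  and one of the two largest among them, which forces \<open>p \<le> 2\<close>.\<close>

lemma lobster_labeling_extreme:
  assumes "edge_consecutive_magic_labeling b (lobster_verts p) (lobster_edges p) lam" and p: "p \<ge> 3"
  shows "b = 0 \<or> b = 2 * p + 1"
proof (rule ccontr)
  interpret edge_consecutive_labeling b "lobster_verts p" "lobster_edges p" lam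
    by unfold_locales fact
  note cards = card_lobster_verts card_lobster_edges
  assume *: "\<not> (b = 0 \<or> b = 2 * p + 1)"
  have "b \<le> 2 * p + 1"
    using labeling by (simp add: edge_consecutive_magic_labeling_def cards)
  with * have b: "0 < b" "b < 2 * p + 1"
    by auto
  have C: "Center \<in> lobster_verts p"
    by (simp add: lobster_verts_def)
  have legs: "{Center, Mid i} \<in> lobster_edges p" "{Mid i, Leaf i} \<in> lobster_edges p"
      "Mid i \<in> lobster_verts p" "Leaf i \<in> lobster_verts p"
    if "i \<in> {1..p}" for i
    using that by (auto simp: lobster_edges_def lobster_verts_def)
  have side: "crossing {u, v} \<longleftrightarrow> (label u \<le> b \<longleftrightarrow> \<not> label v \<le> b)"
    if "u \<in> lobster_verts p" "v \<in> lobster_verts p" for u v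
    using that unfolding crossing_def doubleton_eq_iff by (metis not_le)
  \<comment> \<open>Without a crossing edge all vertices would be on the side of the center, by connectedness,
    but both the smallest and the largest label belong to vertices.\<close>
  have "\<exists>d\<in>lobster_edges p. crossing d"
  proof (rule ccontr)
    assume "\<not> ?thesis"
    then have none: "\<not> crossing d" if "d \<in> lobster_edges p" for d
      using that by blast
    have "label (Mid i) \<le> b \<longleftrightarrow> label Center \<le> b" "label (Leaf i) \<le> b \<longleftrightarrow> label Center \<le> b"
      if "i \<in> {1..p}" for i
      using side[OF C legs(3)[OF that]] side[OF legs(3)[OF that] legs(4)[OF that]]
        none[OF legs(1)[OF that]] none[OF legs(2)[OF that]] by auto
    then have same: "label v \<le> b \<longleftrightarrow> label Center \<le> b" if "v \<in> lobster_verts p" for v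
      using that by (auto simp: lobster_verts_def)
    have "1 \<in> label ` lobster_verts p" "4 * p + 1 \<in> label ` lobster_verts p"
      unfolding labels cards using b by auto
    then obtain u v where "u \<in> lobster_verts p" "label u = 1" "v \<in> lobster_verts p" "label v = 4 * p + 1"
      by (metis imageE)
    then show False
      using same[of u] same[of v] b by auto
  qed
  then have cross: "\<forall>e\<in>lobster_edges p. crossing e"
    using all_crossing by (auto simp: cards)
  have mid: "label (Mid i) \<le> b \<longleftrightarrow> \<not> label Center \<le> b"
    and leaf: "label (Leaf i) \<le> b \<longleftrightarrow> label Center \<le> b" if "i \<in> {1..p}" for i
    using side[OF C legs(3)[OF that]] side[OF legs(3)[OF that] legs(4)[OF that]]
      bspec[OF cross legs(1)[OF that]] bspec[OF cross legs(2)[OF that]] by auto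
  obtain d e where "d \<in> lobster_edges p" "e \<in> lobster_edges p" "d \<noteq> e" "d \<inter> e \<noteq> {}"
    "\<forall>v\<in>d \<union> e. label v \<le> 2 \<or> b < label v \<and> label v \<le> b + 2 * p + 2"
    using smallest_sums[OF _ cross] p by (auto simp: cards)
  with center_in_adjacent_edges have small: "label Center \<le> 2 \<or> b < label Center \<and> label Center \<le> b + 2 * p + 2"
    by blast
  obtain d e where "d \<in> lobster_edges p" "e \<in> lobster_edges p" "d \<noteq> e" "d \<inter> e \<noteq> {}"
    "\<forall>v\<in>d \<union> e. label v \<le> b \<and> b \<le> label v + 1 \<or> 4 * p + 1 \<le> label v + 1"
    using largest_sums[OF _ cross] p by (auto simp: cards)
  with center_in_adjacent_edges have large: "label Center \<le> b \<and> b \<le> label Center + 1 \<or> 4 * p + 1 \<le> label Center + 1"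
    by blast
  have card_Mid: "card (Mid ` {1..p}) = p"
    by (simp add: card_image inj_on_def)
  \<comment> \<open>The number of low vertices determines \<open>b\<close>, which makes the two bounds on the center clash.\<close>
  show False
  proof (cases "label Center \<le> b")
    case True
    have "{v \<in> lobster_verts p. label v \<le> b} = lobster_verts p - Mid ` {1..p}"
      using True mid leaf by (auto simp: lobster_verts_def)
    then have "b = card (lobster_verts p - Mid ` {1..p})"
      using card_low by simp
    also have "\<dots> = p + 1"
    proof (subst card_Diff_subset)
      show "Mid ` {1..p} \<subseteq> lobster_verts p"
        by (auto simp: lobster_verts_def)
    qed (simp_all add: cards card_image inj_on_def)
    finally show False
      using True small large p by auto
  next
    case False
    have "{v \<in> lobster_verts p. label v \<le> b} = Mid ` {1..p}"
      using False mid leaf by (auto simp: lobster_verts_def)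
    then have "b = p"
      using card_low card_Mid by simp
    then show False
      using False small large p by auto
  qed
qed

theorem theorem11:
  fixes p b :: nat
  assumes "p \<ge> 3"
  shows "(\<exists>lam. edge_consecutive_magic_labeling b (lobster_verts p) (lobster_edges p) lam) \<longleftrightarrow>
         b \<in> {0, 2 * p + 1}"
proof
  assume "\<exists>lam. edge_consecutive_magic_labeling b (lobster_verts p) (lobster_edges p) lam"
  then show "b \<in> {0, 2 * p + 1}"
    using lobster_labeling_extreme[OF _ assms] by auto
next
  assume b: "b \<in> {0, 2 * p + 1}"
  show "\<exists>lam. edge_consecutive_magic_labeling b (lobster_verts p) (lobster_edges p) lam"
  proof (cases "even p")
    case True
    with assms have p: "p \<ge> 4"
      by (cases "p = 3") simp_all
    show ?thesis
      by (rule even_lobster_labeling[OF True p b])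
  next
    case False
    then show ?thesis
      using b by (rule odd_lobster_labeling)
  qed
qed

end
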